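(* Let $\mathfrak{X}$ be a nonempty set. The maps $\delta,\sigma,\iota,\alpha:\ell^\infty(\mathfrak{X})\to\mathbb{R}$ given by $\delta(f)=\|f\|_\infty$, $\sigma(f)=\sup_{\mathfrak{X}}f$, $\iota(f)=\inf_{\mathfrak{X}}f$, $\alpha(f)=\sup_{\mathfrak{X}}f-\inf_{\mathfrak{X}}f$ are Hadamard directionally differentiable at every $f\in\ell^\infty(\mathfrak{X})\setminus\{0\}$. For $g\in\ell^\infty(\mathfrak{X})$, their derivatives are respectively $$\delta'_f(g)=\lim_{\epsilon\downarrow0}\sup_{A_\epsilon(|f|)}\big(g\cdot\operatorname{sgn}(f)\big),\qquad \sigma'_f(g)=\lim_{\epsilon\downarrow0}\sup_{A_\epsilon(f)}g,$$ $$\iota'_f(g)=\lim_{\epsilon\downarrow0}\inf_{B_\epsilon(f)}g,\qquad \alpha'_f(g)=\lim_{\epsilon\downarrow0}\Big(\sup_{A_\epsilon(f)}g-\inf_{B_\epsilon(f)}g\Big),$$ where, for $\epsilon>0$ and $h\in\ell^\infty(\mathfrak{X})$, $$A_\epsilon(h)=\Big\{x\in\mathfrak{X}:h(x)\ge\sup_{\mathfrak{X}}h-\epsilon\Big\},\qquad B_\epsilon(h)=\Big\{x\in\mathfrak{X}:h(x)\le\inf_{\mathfrak{X}}h+\epsilon\Big\}.$$ Moreover, if $(\mathfrak{X},\mathcal{A},\mu)$ is a measure space, the same result holds on $\ell^\infty(\mathfrak{X},\mathcal{A},\mu)$ when all suprema (respectively infima), in the definitions of the maps, of the sets $A_\epsilon,B_\epsilon$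 and of the derivatives, are replaced by essential suprema (respectively essential infima) with respect to $\mu$.
   Context: $\ell^\infty(\mathfrak{X})$ is the real Banach space of bounded functions $f:\mathfrak{X}\to\mathbb{R}$ with norm $\|f\|_\infty=\sup_{x\in\mathfrak{X}}|f(x)|$. If $(\mathfrak{X},\mathcal{A},\mu)$ is a measure space with $\mu$ a positive measure, $\ell^\infty(\mathfrak{X},\mathcal{A},\mu)$ is the set of equivalence classes of measurable essentially bounded functions $f:\mathfrak{X}\to\mathbb{R}$ with norm $\operatorname{ess\,sup}_{x\in\mathfrak X}|f(x)|$, where $\operatorname{ess\,sup}_{\mathfrak{X}}f=\inf\{C\in\mathbb{R}:\mu(\{x\in\mathfrak{X}:f(x)>C\})=0\}$ (and the essential infimum is defined dually). $\operatorname{sgn}$ is the sign function. Hadamard directional differentiability: let $\mathcal{D},\mathcal{E}$ be real Banach spaces. A map $\phi:\mathcal{D}\to\mathcal{E}$ is Hadamard directionally differentiable at $\theta\in\mathcal{D}$ tangentially to a set $\mathcal{D}_0\subset\mathcal{D}$ if there is a map $\phi'_\theta:\mathcal{D}_0\to\mathcal{E}$ (the derivative, not required to be linear) such that $\big\|\frac{\phi(\theta+t_nh_n)-\phi(\theta)}{t_n}-\phi'_\theta(h)\big\|_{\mathcal{E}}\to0$ for all $h\in\mathcal{D}_0$ and all sequences $\{t_n\}\subset\mathbb{R}$, $\{h_n\}\subset\mathcal{D}$ with $t_n\downarrow0$ and $\|h_n-h\|_{\mathcal{D}}\to0$. When no tangency set is mentioned, $\mathcal{D}_0=\mathcal{D}$.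 *)

theory Defs
  imports "HOL-Analysis.Analysis" "HOL-Probability.Essential_Supremum"
begin

section \<open>Normed spaces with an explicit carrier\<close>

text \<open>
  Neither the bounded functions on a set \<open>X\<close> nor the essentially bounded functions modulo a
  measure \<open>M\<close> form a type, so the source space of a Hadamard differentiable map is given by its
  carrier and operations.
\<close>

record 'v vspace =
  vcarrier :: "'v set"
  vzero :: 'v
  vadd :: "'v \<Rightarrow> 'v \<Rightarrow> 'v"
  vscale :: "real \<Rightarrow> 'v \<Rightarrow> 'v"
  vnorm :: "'v \<Rightarrow> real"

definition vdiff :: "'v vspace \<Rightarrow> 'v \<Rightarrow> 'v \<Rightarrow> 'v" where
  "vdiff V a b = vadd V a (vscale V (-1) b)"

text \<open>
  \<open>t \<down> 0\<close> is read as \<open>t n > 0\<close> and \<open>t \<longlonglongrightarrow> 0\<close>; monotonicity is not required.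
  Only the values of \<open>\<phi>'\<close> on the tangency set \<open>D0\<close> matter.
\<close>

definition has_hadamard_deriv ::
  "'v vspace \<Rightarrow> 'v set \<Rightarrow> ('v \<Rightarrow> 'e::banach) \<Rightarrow> 'v \<Rightarrow> ('v \<Rightarrow> 'e) \<Rightarrow> bool" where
  "has_hadamard_deriv V D0 \<phi> \<theta> \<phi>' \<longleftrightarrow>
    (\<forall>h\<in>D0. \<forall>(t :: nat \<Rightarrow> real) H.
       (\<forall>n. t n > 0) \<longrightarrow> t \<longlonglongrightarrow> 0 \<longrightarrow>
       (\<forall>n. H n \<in> vcarrier V) \<longrightarrow> (\<lambda>n. vnorm V (vdiff V (H n) h)) \<longlonglongrightarrow> 0 \<longrightarrow>
       (\<lambda>n. norm ((\<phi> (vadd V \<theta> (vscale V (t n) (H n))) - \<phi> \<theta>) /\<^sub>R t n - \<phi>' h)) \<longlonglongrightarrow> 0)"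


section \<open>Bounded functions on a set\<close>

text \<open>Functions on \<open>X\<close> are represented by functions that are \<open>undefined\<close> outside \<open>X\<close>.\<close>

definition linf :: "'a set \<Rightarrow> ('a \<Rightarrow> real) vspace" where
  "linf X = \<lparr> vcarrier = {f \<in> extensional X. bounded (f ` X)},
     vzero = (\<lambda>x\<in>X. 0),
     vadd = (\<lambda>f g. \<lambda>x\<in>X. f x + g x),
     vscale = (\<lambda>c f. \<lambda>x\<in>X. c * f x),
     vnorm = (\<lambda>f. SUP x\<in>X. \<bar>f x\<bar>) \<rparr>"

definition near_sup :: "'a set \<Rightarrow> real \<Rightarrow> ('a \<Rightarrow> real) \<Rightarrow> 'a set" where
  "near_sup X \<epsilon> h = {x\<in>X. h x \<ge> (SUP y\<in>X. h y) - \<epsilon>}"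

definition near_inf :: "'a set \<Rightarrow> real \<Rightarrow> ('a \<Rightarrow> real) \<Rightarrow> 'a set" where
  "near_inf X \<epsilon> h = {x\<in>X. h x \<le> (INF y\<in>X. h y) + \<epsilon>}"


section \<open>Essential suprema and infima\<close>

text \<open>
  Real-valued, over a subset \<open>A\<close> of \<open>space M\<close>. They are meaningful for essentially bounded
  functions and non-null \<open>A\<close>; a null \<open>A\<close> yields an unspecified infimum over \<open>UNIV\<close>.
\<close>

definition ess_sup_on :: "'a measure \<Rightarrow> 'a set \<Rightarrow> ('a \<Rightarrow> real) \<Rightarrow> real" where
  "ess_sup_on M A f = Inf {C. emeasure M {x\<in>A. f x > C} = 0}"

definition ess_inf_on :: "'a measure \<Rightarrow> 'a set \<Rightarrow> ('a \<Rightarrow> real) \<Rightarrow> real" where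
  "ess_inf_on M A f = Sup {C. emeasure M {x\<in>A. f x < C} = 0}"

abbreviation ess_sup :: "'a measure \<Rightarrow> ('a \<Rightarrow> real) \<Rightarrow> real" where
  "ess_sup M \<equiv> ess_sup_on M (space M)"

abbreviation ess_inf :: "'a measure \<Rightarrow> ('a \<Rightarrow> real) \<Rightarrow> real" where
  "ess_inf M \<equiv> ess_inf_on M (space M)"

definition near_ess_sup :: "'a measure \<Rightarrow> real \<Rightarrow> ('a \<Rightarrow> real) \<Rightarrow> 'a set" where
  "near_ess_sup M \<epsilon> h = {x\<in>space M. h x \<ge> ess_sup M h - \<epsilon>}"

definition near_ess_inf :: "'a measure \<Rightarrow> real \<Rightarrow> ('a \<Rightarrow> real) \<Rightarrow> 'a set" where
  "near_ess_inf M \<epsilon> h = {x\<in>space M. h x \<le> ess_inf M h + \<epsilon>}"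

lemma ess_inf_on_eq: "ess_inf_on M A f = - ess_sup_on M A (\<lambda>x. - f x)"
proof -
  define S where "S = {C. emeasure M {x\<in>A. - f x > C} = 0}"
  have "{C. emeasure M {x\<in>A. f x < C} = 0} = uminus ` S"
  proof (rule set_eqI)
    fix C :: real
    have "{x\<in>A. - f x > - C} = {x\<in>A. f x < C}"
      by auto
    then have "- C \<in> S \<longleftrightarrow> emeasure M {x\<in>A. f x < C} = 0"
      by (simp only: S_def mem_Collect_eq)
    moreover have "C \<in> uminus ` S \<longleftrightarrow> - C \<in> S"
      by (metis image_iff minus_minus)
    ultimately show "C \<in> {C. emeasure M {x\<in>A. f x < C} = 0} \<longleftrightarrow> C \<in> uminus ` S"
      by (simp only: mem_Collect_eq)
  qed
  then have "ess_inf_on M A f = Sup (uminus ` S)"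
    by (simp only: ess_inf_on_def)
  also have "\<dots> = - Inf S"
    by (simp only: Inf_real_def minus_minus)
  finally show ?thesis
    by (simp only: ess_sup_on_def S_def)
qed

text \<open>Agreement with the library's extended-real essential supremum.\<close>

lemma ereal_ess_sup_on:
  assumes A: "A \<in> sets M" "emeasure M A \<noteq> 0"
    and f: "f \<in> borel_measurable M" and b: "AE x in M. \<bar>f x\<bar> \<le> b"
  shows "ereal (ess_sup_on M A f) = esssup (restrict_space M A) (\<lambda>x. ereal (f x))"
proof -
  let ?N = "restrict_space M A"
  let ?S = "{C::real. emeasure M {x\<in>A. f x > C} = 0}"
  let ?e = "esssup ?N (\<lambda>x. ereal (f x))"
  have sp: "space ?N = A"
    using A sets.sets_into_space by (auto simp: space_restrict_space)
  have meas [measurable]: "(\<lambda>x. ereal (f x)) \<in> borel_measurable ?N"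
    using f by (intro borel_measurable_ereal measurable_restrict_space1)
  have AE: "AE x in ?N. \<bar>f x\<bar> \<le> b"
    using b A by (subst AE_restrict_space_iff) auto
  have emN: "emeasure ?N {x\<in>A. P x} = emeasure M {x\<in>A. P x}" for P
    using A by (intro emeasure_restrict_space) auto
  have nn: "emeasure ?N (space ?N) \<noteq> 0"
    using A emN[of "\<lambda>_. True"] by (simp add: sp)
  have up: "?e \<le> ereal b"
    using AE by (intro esssup_I meas) (auto elim!: eventually_mono)
  have lo: "ereal (- b) \<le> ?e"
  proof -
    have "esssup ?N (\<lambda>_. ereal (- b)) \<le> ?e"
      using AE by (intro esssup_AE_mono) (auto elim!: eventually_mono)
    then show ?thesis using esssup_const[OF nn] by metis
  qed
  obtain r where r: "?e = ereal r"
    using up lo by (cases ?e) auto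
  have eq: "?e = Inf {z. emeasure M {x\<in>A. ereal (f x) > z} = 0}"
    using esssup_eq[OF meas] by (simp add: sp emN)
  have "r \<in> ?S"
    using esssup_zero_measure[of ?N "\<lambda>x. ereal (f x)"] by (simp add: r sp emN)
  moreover have "r \<le> C" if "C \<in> ?S" for C
  proof -
    have "?e \<le> ereal C" unfolding eq using that by (intro Inf_lower) auto
    then show ?thesis by (simp add: r)
  qed
  ultimately have "ess_sup_on M A f = r"
    unfolding ess_sup_on_def by (intro cInf_eq_minimum) auto
  then show ?thesis by (simp add: r)
qed


section \<open>Classes of essentially bounded measurable functions\<close>

definition ess_bdd :: "'a measure \<Rightarrow> ('a \<Rightarrow> real) set" where
  "ess_bdd M = {f \<in> borel_measurable M. \<exists>C. AE x in M. \<bar>f x\<bar> \<le> C}"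

definition ae_rel :: "'a measure \<Rightarrow> (('a \<Rightarrow> real) \<times> ('a \<Rightarrow> real)) set" where
  "ae_rel M = {(f, g). f \<in> ess_bdd M \<and> g \<in> ess_bdd M \<and> (AE x in M. f x = g x)}"

text \<open>The common value on a class of a functional that respects a.e. equality.\<close>

definition on_class :: "(('a \<Rightarrow> real) \<Rightarrow> 'b) \<Rightarrow> ('a \<Rightarrow> real) set \<Rightarrow> 'b" where
  "on_class \<phi> F = the_elem (\<phi> ` F)"

definition Linf :: "'a measure \<Rightarrow> ('a \<Rightarrow> real) set vspace" where
  "Linf M = \<lparr> vcarrier = ess_bdd M // ae_rel M,
     vzero = ae_rel M `` {\<lambda>x. 0},
     vadd = (\<lambda>F G. \<Union>f\<in>F. \<Union>g\<in>G. ae_rel M `` {\<lambda>x. f x + g x}),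
     vscale = (\<lambda>c F. \<Union>f\<in>F. ae_rel M `` {\<lambda>x. c * f x}),
     vnorm = on_class (\<lambda>f. ess_sup M (\<lambda>x. \<bar>f x\<bar>)) \<rparr>"

lemma equiv_ae_rel: "equiv (ess_bdd M) (ae_rel M)"
proof (rule equivI)
  show "ae_rel M \<subseteq> ess_bdd M \<times> ess_bdd M" by (auto simp: ae_rel_def)
  show "refl_on (ess_bdd M) (ae_rel M)" by (auto simp: ae_rel_def refl_on_def)
  show "sym (ae_rel M)"
    by (rule symI) (auto simp: ae_rel_def elim!: eventually_mono)
  show "trans (ae_rel M)"
  proof (rule transI)
    fix f g h assume fg: "(f, g) \<in> ae_rel M" and gh: "(g, h) \<in> ae_rel M"
    then have "AE x in M. f x = g x" "AE x in M. g x = h x" by (auto simp: ae_rel_def)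
    then have "AE x in M. f x = h x" by eventually_elim simp
    with fg gh show "(f, h) \<in> ae_rel M" by (auto simp: ae_rel_def)
  qed
qed

lemma ess_bdd_add: "f \<in> ess_bdd M \<Longrightarrow> g \<in> ess_bdd M \<Longrightarrow> (\<lambda>x. f x + g x) \<in> ess_bdd M"
proof -
  assume f: "f \<in> ess_bdd M" and g: "g \<in> ess_bdd M"
  then obtain C D where "AE x in M. \<bar>f x\<bar> \<le> C" "AE x in M. \<bar>g x\<bar> \<le> D"
    by (auto simp: ess_bdd_def)
  then have "AE x in M. \<bar>f x + g x\<bar> \<le> C + D"
    by eventually_elim linarith
  with f g show ?thesis by (auto simp: ess_bdd_def)
qed

lemma ess_bdd_scale: "f \<in> ess_bdd M \<Longrightarrow> (\<lambda>x. c * f x) \<in> ess_bdd M"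
proof -
  assume f: "f \<in> ess_bdd M"
  then obtain C where "AE x in M. \<bar>f x\<bar> \<le> C"
    by (auto simp: ess_bdd_def)
  then have "AE x in M. \<bar>c * f x\<bar> \<le> \<bar>c\<bar> * C"
    by eventually_elim (simp add: abs_mult mult_left_mono)
  with f show ?thesis by (auto simp: ess_bdd_def)
qed

lemma vadd_Linf_class:
  assumes "f \<in> ess_bdd M" "g \<in> ess_bdd M"
  shows "vadd (Linf M) (ae_rel M `` {f}) (ae_rel M `` {g}) = ae_rel M `` {\<lambda>x. f x + g x}"
proof -
  have "congruent2 (ae_rel M) (ae_rel M) (\<lambda>f g. ae_rel M `` {\<lambda>x. f x + g x})"
  proof (intro congruent2I' equiv_class_eq[OF equiv_ae_rel])
    fix f f' g g' assume r: "(f, f') \<in> ae_rel M" "(g, g') \<in> ae_rel M"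
    then have "AE x in M. f x = f' x" "AE x in M. g x = g' x" by (auto simp: ae_rel_def)
    then have "AE x in M. f x + g x = f' x + g' x" by eventually_elim simp
    with r show "(\<lambda>x. f x + g x, \<lambda>x. f' x + g' x) \<in> ae_rel M"
      by (simp add: ae_rel_def ess_bdd_add)
  qed
  from UN_equiv_class2[OF equiv_ae_rel equiv_ae_rel this assms] show ?thesis
    by (simp add: Linf_def)
qed

lemma vscale_Linf_class:
  assumes "f \<in> ess_bdd M"
  shows "vscale (Linf M) c (ae_rel M `` {f}) = ae_rel M `` {\<lambda>x. c * f x}"
proof -
  have "congruent (ae_rel M) (\<lambda>f. ae_rel M `` {\<lambda>x. c * f x})"
  proof (intro congruentI equiv_class_eq[OF equiv_ae_rel])
    fix f f' assume r: "(f, f') \<in> ae_rel M"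
    then have "AE x in M. f x = f' x" by (auto simp: ae_rel_def)
    then have "AE x in M. c * f x = c * f' x" by eventually_elim simp
    with r show "(\<lambda>x. c * f x, \<lambda>x. c * f' x) \<in> ae_rel M"
      by (simp add: ae_rel_def ess_bdd_scale)
  qed
  from UN_equiv_class[OF equiv_ae_rel this assms] show ?thesis
    by (simp add: Linf_def)
qed

lemma on_class_eq:
  assumes "f \<in> ess_bdd M" and "\<And>g. (f, g) \<in> ae_rel M \<Longrightarrow> \<phi> g = \<phi> f"
  shows "on_class \<phi> (ae_rel M `` {f}) = \<phi> f"
proof -
  have "f \<in> ae_rel M `` {f}"
    using equiv_ae_rel assms(1) by (rule equiv_class_self)
  moreover have "\<phi> g = \<phi> f" if "g \<in> ae_rel M `` {f}" for g
    using that by (intro assms(2)) simp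
  ultimately have "\<phi> ` (ae_rel M `` {f}) = {\<phi> f}"
    by blast
  then show ?thesis by (simp add: on_class_def)
qed

lemma ess_sup_on_cong_AE:
  assumes "A \<in> sets M" "f \<in> borel_measurable M" "g \<in> borel_measurable M"
    and "AE x in M. f x = g x"
  shows "ess_sup_on M A f = ess_sup_on M A g"
proof -
  have "emeasure M {x\<in>A. f x > C} = emeasure M {x\<in>A. g x > C}" for C
  proof (rule emeasure_eq_AE)
    show "AE x in M. (x \<in> {x\<in>A. f x > C}) = (x \<in> {x\<in>A. g x > C})"
      using assms(4) by eventually_elim simp
    have "{x\<in>A. f x > C} = {x\<in>space M. f x > C} \<inter> A" "{x\<in>A. g x > C} = {x\<in>space M. g x > C} \<inter> A"
      using sets.sets_into_space[OF assms(1)] by auto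
    then show "{x\<in>A. f x > C} \<in> sets M" "{x\<in>A. g x > C} \<in> sets M"
      using assms(1-3) by simp_all
  qed
  then show ?thesis by (simp add: ess_sup_on_def)
qed

lemma ess_sup_class:
  assumes "f \<in> ess_bdd M"
  shows "on_class (ess_sup M) (ae_rel M `` {f}) = ess_sup M f"
proof (rule on_class_eq[OF assms])
  fix g assume "(f, g) \<in> ae_rel M"
  then show "ess_sup M g = ess_sup M f"
    using ess_sup_on_cong_AE[of "space M" M f g] by (simp add: ae_rel_def ess_bdd_def)
qed

lemma ess_inf_class:
  assumes "f \<in> ess_bdd M"
  shows "on_class (ess_inf M) (ae_rel M `` {f}) = ess_inf M f"
proof (rule on_class_eq[OF assms])
  fix g assume "(f, g) \<in> ae_rel M"
  then show "ess_inf M g = ess_inf M f"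
    using ess_sup_on_cong_AE[of "space M" M "\<lambda>x. - f x" "\<lambda>x. - g x"]
    by (simp add: ae_rel_def ess_bdd_def ess_inf_on_eq)
qed

lemma vnorm_Linf_class:
  assumes "f \<in> ess_bdd M"
  shows "vnorm (Linf M) (ae_rel M `` {f}) = ess_sup M (\<lambda>x. \<bar>f x\<bar>)"
proof -
  have "on_class (\<lambda>f. ess_sup M (\<lambda>x. \<bar>f x\<bar>)) (ae_rel M `` {f}) = ess_sup M (\<lambda>x. \<bar>f x\<bar>)"
  proof (rule on_class_eq[OF assms])
    fix g assume "(f, g) \<in> ae_rel M"
    then have "f \<in> borel_measurable M" "g \<in> borel_measurable M" and ae: "AE x in M. f x = g x"
      by (auto simp: ae_rel_def ess_bdd_def)
    moreover have "AE x in M. \<bar>g x\<bar> = \<bar>f x\<bar>"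
      using ae by eventually_elim simp
    ultimately show "ess_sup M (\<lambda>x. \<bar>g x\<bar>) = ess_sup M (\<lambda>x. \<bar>f x\<bar>)"
      by (intro ess_sup_on_cong_AE) auto
  qed
  then show ?thesis by (simp add: Linf_def)
qed

end

theory Submission
  imports Defs
begin

text \<open>
  For the counting measure on \<open>X\<close> the essential supremum of a bounded function is its supremum, so
  both parts follow from statements about essential suprema. Write \<open>s\<close> for the essential supremum
  of \<open>f\<close> and \<open>E \<epsilon>\<close> for that of \<open>h\<close> on \<open>A\<^sub>\<epsilon>(f)\<close>. On \<open>A\<^sub>\<epsilon>(f)\<close>, \<open>f + t h\<close> is at most \<open>s + t E \<epsilon>\<close>, and
  off \<open>A\<^sub>\<epsilon>(f)\<close> it is at most \<open>s - \<epsilon> + t K\<close>, which is smaller once \<open>t\<close> is small; hence the difference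
  quotients are eventually at most \<open>E \<epsilon>\<close>. Conversely \<open>f + t h \<ge> s - \<epsilon> + t h\<close> on \<open>A\<^sub>\<epsilon>(f)\<close>, and letting
  \<open>\<epsilon> \<down> 0\<close> with \<open>t\<close> fixed bounds the quotient below by \<open>lim E\<close>. The norm reduces to this with
  \<open>\<bar>f\<bar>\<close> and \<open>g sgn f\<close> in place of \<open>f\<close> and \<open>h\<close>, the infimum through \<open>- f\<close>.
\<close>

section \<open>Essentially bounded functions and bounds for essential suprema\<close>

lemma ess_bdd_abs: "f \<in> ess_bdd M \<Longrightarrow> (\<lambda>x. \<bar>f x\<bar>) \<in> ess_bdd M"
  by (auto simp: ess_bdd_def)

lemma ess_bdd_uminus: "f \<in> ess_bdd M \<Longrightarrow> (\<lambda>x. - f x) \<in> ess_bdd M"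
  by (auto simp: ess_bdd_def)

lemma ess_bdd_diff: "f \<in> ess_bdd M \<Longrightarrow> g \<in> ess_bdd M \<Longrightarrow> (\<lambda>x. f x - g x) \<in> ess_bdd M"
  using ess_bdd_add[of f M "\<lambda>x. - g x"] ess_bdd_uminus[of g M] by simp

lemma ess_bdd_mult_sgn:
  assumes f: "f \<in> ess_bdd M" and g: "g \<in> ess_bdd M"
  shows "(\<lambda>x. g x * sgn (f x)) \<in> ess_bdd M"
proof -
  obtain C where C: "AE x in M. \<bar>g x\<bar> \<le> C" using g by (auto simp: ess_bdd_def)
  have "AE x in M. \<bar>g x * sgn (f x)\<bar> \<le> C"
    using C by eventually_elim (auto simp: abs_mult sgn_if)
  moreover have "(\<lambda>x. g x * sgn (f x)) \<in> borel_measurable M"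
    using f g by (auto simp: ess_bdd_def)
  ultimately show ?thesis by (auto simp: ess_bdd_def)
qed

text \<open>Over a non-null \<open>A\<close> the value is \<open>esssup\<close> for the measure
  restricted to \<open>A\<close>, which is an a.e. upper bound and lies below every other one.
  Comparisons of essential suprema thereby become a.e. inequalities.\<close>

lemma ess_sup_on_le_iff:
  assumes A: "A \<in> sets M" "emeasure M A \<noteq> 0" and f: "f \<in> ess_bdd M"
  shows "ess_sup_on M A f \<le> C \<longleftrightarrow> (AE x in M. x \<in> A \<longrightarrow> f x \<le> C)"
proof -
  let ?N = "restrict_space M A"
  obtain b where b: "AE x in M. \<bar>f x\<bar> \<le> b" and f': "f \<in> borel_measurable M"
    using f by (auto simp: ess_bdd_def)
  have eq: "ereal (ess_sup_on M A f) = esssup ?N (\<lambda>x. ereal (f x))"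
    by (rule ereal_ess_sup_on[OF A f' b])
  have meas: "(\<lambda>x. ereal (f x)) \<in> borel_measurable ?N"
    using f' by (intro borel_measurable_ereal measurable_restrict_space1)
  have AEN: "(AE x in ?N. P x) \<longleftrightarrow> (AE x in M. x \<in> A \<longrightarrow> P x)" for P
    using A by (intro AE_restrict_space_iff) auto
  have "AE x in ?N. ereal (f x) \<le> ereal (ess_sup_on M A f)"
    unfolding eq by (rule esssup_AE)
  then have 1: "AE x in M. x \<in> A \<longrightarrow> f x \<le> ess_sup_on M A f"
    by (simp add: AEN)
  show ?thesis
  proof
    assume "ess_sup_on M A f \<le> C"
    with 1 show "AE x in M. x \<in> A \<longrightarrow> f x \<le> C"
      by (auto elim!: eventually_mono)
  next
    assume "AE x in M. x \<in> A \<longrightarrow> f x \<le> C"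
    then have "AE x in ?N. ereal (f x) \<le> ereal C" by (simp add: AEN)
    then have "esssup ?N (\<lambda>x. ereal (f x)) \<le> ereal C" by (rule esssup_I[OF meas])
    then show "ess_sup_on M A f \<le> C" by (simp flip: eq)
  qed
qed

lemma AE_le_ess_sup_on:
  assumes "A \<in> sets M" "emeasure M A \<noteq> 0" "f \<in> ess_bdd M"
  shows "AE x in M. x \<in> A \<longrightarrow> f x \<le> ess_sup_on M A f"
  using ess_sup_on_le_iff[OF assms] by blast

text \<open>If the essential supremum were below \<open>K\<close>, almost no point could lie in
  \<open>A\<close>, against \<open>A\<close> being non-null.\<close>

lemma ess_sup_on_ge:
  assumes A: "A \<in> sets M" "emeasure M A \<noteq> 0" and f: "f \<in> ess_bdd M"
    and K: "AE x in M. K \<le> f x"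
  shows "K \<le> ess_sup_on M A f"
proof (rule ccontr)
  assume lt: "\<not> ?thesis"
  have "AE x in M. x \<notin> A"
    using AE_le_ess_sup_on[OF A f] K by eventually_elim (use lt in auto)
  then have "emeasure M A = 0"
    using A(1) AE_iff_null_sets by blast
  with A(2) show False by simp
qed

lemma ess_sup_le_iff:
  assumes "emeasure M (space M) \<noteq> 0" "f \<in> ess_bdd M"
  shows "ess_sup M f \<le> C \<longleftrightarrow> (AE x in M. f x \<le> C)"
  using ess_sup_on_le_iff[OF sets.top assms] by auto

lemma AE_le_ess_sup:
  assumes "emeasure M (space M) \<noteq> 0" "f \<in> ess_bdd M"
  shows "AE x in M. f x \<le> ess_sup M f"
  using ess_sup_le_iff[OF assms] by blast

text \<open>On a null space every property holds a.e.; a function that is not a.e. zero therefore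
  forces \<open>M\<close> to be non-null.\<close>

lemma nonnull_if_not_AE:
  assumes "\<not> (AE x in M. P x)" shows "emeasure M (space M) \<noteq> 0"
  using assms by (metis AE_I' null_setsI sets.top Collect_subset)

section \<open>Near-maximal sets and the limit of essential suprema over them\<close>

lemma near_ess_inf_eq: "near_ess_inf M \<epsilon> f = near_ess_sup M \<epsilon> (\<lambda>x. - f x)"
  by (auto simp: near_ess_inf_def near_ess_sup_def ess_inf_on_eq)

lemma near_ess_sup_sets:
  assumes "f \<in> ess_bdd M"
  shows "near_ess_sup M \<epsilon> f \<in> sets M"
proof -
  have [measurable]: "f \<in> borel_measurable M" using assms by (simp add: ess_bdd_def)
  show ?thesis unfolding near_ess_sup_def by measurable
qed

text \<open>Were the set null, \<open>ess_sup M f - \<epsilon>\<close> would be a smaller a.e. upper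
  bound of \<open>f\<close>. This keeps essential suprema over these sets away from the unspecified
  value on null sets.\<close>

lemma near_ess_sup_nonnull:
  assumes nn: "emeasure M (space M) \<noteq> 0" and f: "f \<in> ess_bdd M" and "\<epsilon> > 0"
  shows "emeasure M (near_ess_sup M \<epsilon> f) \<noteq> 0"
proof
  assume "emeasure M (near_ess_sup M \<epsilon> f) = 0"
  then have "near_ess_sup M \<epsilon> f \<in> null_sets M"
    using near_ess_sup_sets[OF f] by auto
  then have "AE x in M. x \<notin> near_ess_sup M \<epsilon> f" by (rule AE_not_in)
  then have "AE x in M. f x \<le> ess_sup M f - \<epsilon>"
    using AE_space by eventually_elim (auto simp: near_ess_sup_def)
  then have "ess_sup M f \<le> ess_sup M f - \<epsilon>" by (simp add: ess_sup_le_iff[OF nn f])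
  with \<open>\<epsilon> > 0\<close> show False by simp
qed

lemma ess_sup_near_mono:
  assumes nn: "emeasure M (space M) \<noteq> 0" and f: "f \<in> ess_bdd M" and h: "h \<in> ess_bdd M"
    and "0 < \<epsilon>" "\<epsilon> \<le> \<epsilon>'"
  shows "ess_sup_on M (near_ess_sup M \<epsilon> f) h \<le> ess_sup_on M (near_ess_sup M \<epsilon>' f) h"
proof -
  have "AE x in M. x \<in> near_ess_sup M \<epsilon>' f \<longrightarrow> h x \<le> ess_sup_on M (near_ess_sup M \<epsilon>' f) h"
    using assms by (intro AE_le_ess_sup_on near_ess_sup_sets near_ess_sup_nonnull) auto
  then have "AE x in M. x \<in> near_ess_sup M \<epsilon> f \<longrightarrow> h x \<le> ess_sup_on M (near_ess_sup M \<epsilon>' f) h"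
    by eventually_elim (use assms in \<open>auto simp: near_ess_sup_def\<close>)
  then show ?thesis
    by (simp add: ess_sup_on_le_iff near_ess_sup_sets near_ess_sup_nonnull assms)
qed

text \<open>By monotonicity in \<open>\<epsilon>\<close>, the limit from the right at
  \<open>0\<close> is an infimum over all positive \<open>\<epsilon>\<close>.\<close>

definition near_limit :: "'a measure \<Rightarrow> ('a \<Rightarrow> real) \<Rightarrow> ('a \<Rightarrow> real) \<Rightarrow> real" where
  "near_limit M f h = (INF \<epsilon>\<in>{0<..}. ess_sup_on M (near_ess_sup M \<epsilon> f) h)"

lemma near_limit_le:
  assumes nn: "emeasure M (space M) \<noteq> 0" and f: "f \<in> ess_bdd M" and h: "h \<in> ess_bdd M"
    and "0 < \<epsilon>"
  shows "near_limit M f h \<le> ess_sup_on M (near_ess_sup M \<epsilon> f) h"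
proof -
  obtain K where "AE x in M. \<bar>h x\<bar> \<le> K" using h by (auto simp: ess_bdd_def)
  then have "AE x in M. - K \<le> h x" by eventually_elim auto
  \<comment> \<open>\<open>- K\<close> is a lower bound uniform in \<open>\<epsilon>\<close>, so the
    infimum is a genuine one.\<close>
  then have "bdd_below ((\<lambda>\<epsilon>. ess_sup_on M (near_ess_sup M \<epsilon> f) h) ` {0<..})"
    using ess_sup_on_ge[OF near_ess_sup_sets[OF f] near_ess_sup_nonnull[OF nn f] h]
    by (intro bdd_belowI[of _ "- K"]) auto
  then show ?thesis
    unfolding near_limit_def using \<open>0 < \<epsilon>\<close> by (intro cINF_lower) auto
qed

lemma tendsto_near_limit:
  assumes nn: "emeasure M (space M) \<noteq> 0" and f: "f \<in> ess_bdd M" and h: "h \<in> ess_bdd M"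
  shows "((\<lambda>\<epsilon>. ess_sup_on M (near_ess_sup M \<epsilon> f) h) \<longlongrightarrow> near_limit M f h) (at_right 0)"
proof (rule order_tendstoI)
  fix a assume "a < near_limit M f h"
  then show "\<forall>\<^sub>F \<epsilon> in at_right 0. a < ess_sup_on M (near_ess_sup M \<epsilon> f) h"
    using near_limit_le[OF nn f h]
    by (intro eventually_at_rightI[of 0 1]) (auto intro: less_le_trans)
next
  fix b assume "near_limit M f h < b"
  \<comment> \<open>Since the infimum lies below \<open>b\<close>, some value does; by monotonicity
    all smaller \<open>\<epsilon>\<close> inherit this.\<close>
  then obtain \<epsilon>' where \<epsilon>': "\<epsilon>' > 0" "ess_sup_on M (near_ess_sup M \<epsilon>' f) h < b"
    using cInf_lessD[of "(\<lambda>\<epsilon>. ess_sup_on M (near_ess_sup M \<epsilon> f) h) ` {0<..}" b]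
    by (auto simp: near_limit_def)
  show "\<forall>\<^sub>F \<epsilon> in at_right 0. ess_sup_on M (near_ess_sup M \<epsilon> f) h < b"
  proof (rule eventually_at_rightI[of 0 \<epsilon>'])
    fix \<epsilon> assume "\<epsilon> \<in> {0<..<\<epsilon>'}"
    then have "ess_sup_on M (near_ess_sup M \<epsilon> f) h \<le> ess_sup_on M (near_ess_sup M \<epsilon>' f) h"
      by (intro ess_sup_near_mono[OF nn f h]) auto
    with \<epsilon>'(2) show "ess_sup_on M (near_ess_sup M \<epsilon> f) h < b" by simp
  qed (rule \<epsilon>'(1))
qed

section \<open>Difference quotients of the essential supremum\<close>

text \<open>General \<open>u n\<close> cover both a perturbed function and its absolute value. For
  the latter the expansion with error \<open>t n * e n\<close> is only available close to the top,
  hence the restriction to \<open>near_ess_sup M \<epsilon>0 f\<close>; elsewhere \<open>f\<close>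
  has a gap to its essential supremum and the crude one-sided bound \<open>far\<close> is
  enough.\<close>

lemma ess_sup_quotient_tendsto:
  assumes nn: "emeasure M (space M) \<noteq> 0" and f: "f \<in> ess_bdd M" and h: "h \<in> ess_bdd M"
    and u: "\<And>n. u n \<in> ess_bdd M" and t: "\<And>n. t n > 0" "t \<longlonglongrightarrow> 0"
    and e: "e \<longlonglongrightarrow> 0" and "\<epsilon>0 > 0"
    and near: "\<forall>\<^sub>F n in sequentially. AE x in M. x \<in> near_ess_sup M \<epsilon>0 f \<longrightarrow>
        \<bar>u n x - (f x + t n * h x)\<bar> \<le> t n * e n"
    and far: "\<forall>\<^sub>F n in sequentially. AE x in M. u n x \<le> f x + t n * K"
  shows "(\<lambda>n. (ess_sup M (u n) - ess_sup M f) / t n) \<longlonglongrightarrow> near_limit M f h"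
proof -
  define s where "s = ess_sup M f"
  define A where "A \<epsilon> = near_ess_sup M \<epsilon> f" for \<epsilon>
  define E where "E \<epsilon> = ess_sup_on M (A \<epsilon>) h" for \<epsilon>
  define L where "L = near_limit M f h"
  define q where "q n = (ess_sup M (u n) - s) / t n" for n
  have E_iff: "E \<epsilon> \<le> C \<longleftrightarrow> (AE x in M. x \<in> A \<epsilon> \<longrightarrow> h x \<le> C)" if "\<epsilon> > 0" for \<epsilon> C
    unfolding E_def A_def
    using that by (intro ess_sup_on_le_iff near_ess_sup_sets near_ess_sup_nonnull nn f h)
  have LE: "L \<le> E \<epsilon>" if "\<epsilon> > 0" for \<epsilon>
    unfolding L_def E_def A_def by (rule near_limit_le[OF nn f h that])
  have lower: "\<forall>\<^sub>F n in sequentially. L - e n \<le> q n"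
    using near
  proof eventually_elim
    case (elim n)
    have tn: "t n > 0" by (rule t)
    have "L \<le> q n + e n + d" if "d > 0" for d
    proof -
      \<comment> \<open>On \<open>A \<epsilon>\<close>, replacing \<open>f\<close> by
        \<open>s\<close> loses at most \<open>\<epsilon>\<close>, which is at most \<open>d\<close>
        after division by \<open>t n\<close>. The cap \<open>\<epsilon>0\<close> keeps
        \<open>A \<epsilon>\<close> inside the set where the expansion holds.\<close>
      define \<epsilon> where "\<epsilon> = min \<epsilon>0 (t n * d)"
      have \<epsilon>: "\<epsilon> > 0" "\<epsilon> \<le> \<epsilon>0" "\<epsilon> \<le> t n * d"
        using \<open>\<epsilon>0 > 0\<close> that tn by (auto simp: \<epsilon>_def)
      have "AE x in M. u n x \<le> ess_sup M (u n)" by (rule AE_le_ess_sup[OF nn u])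
      then have "AE x in M. x \<in> A \<epsilon> \<longrightarrow> h x \<le> q n + e n + d"
        using elim
      proof (eventually_elim, intro impI)
        fix x assume ux: "u n x \<le> ess_sup M (u n)"
          and near: "x \<in> near_ess_sup M \<epsilon>0 f \<longrightarrow> \<bar>u n x - (f x + t n * h x)\<bar> \<le> t n * e n"
          and x: "x \<in> A \<epsilon>"
        from x have fx: "f x \<ge> s - \<epsilon>" and "x \<in> near_ess_sup M \<epsilon>0 f"
          using \<epsilon> by (auto simp: A_def near_ess_sup_def s_def)
        with near have "\<bar>u n x - (f x + t n * h x)\<bar> \<le> t n * e n" by simp
        then have "t n * h x \<le> (ess_sup M (u n) - s) + t n * e n + t n * d"
          using fx ux \<epsilon> by linarith
        also have "\<dots> = t n * (q n + e n + d)"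
          using tn by (simp add: q_def field_simps)
        finally show "h x \<le> q n + e n + d" using tn by simp
      qed
      then have "E \<epsilon> \<le> q n + e n + d" by (simp add: E_iff \<epsilon>)
      with LE[OF \<epsilon>(1)] show ?thesis by linarith
    qed
    then have "L \<le> q n + e n" by (rule field_le_epsilon)
    then show ?case by simp
  qed
  have upper: "\<forall>\<^sub>F n in sequentially. q n \<le> E \<epsilon> + \<bar>e n\<bar>" if \<epsilon>: "0 < \<epsilon>" "\<epsilon> \<le> \<epsilon>0" for \<epsilon>
  proof -
    \<comment> \<open>Once \<open>t n * (K - E \<epsilon>) < \<epsilon>\<close>, the bound
      \<open>s - \<epsilon> + t n * K\<close> valid off \<open>A \<epsilon>\<close> is below
      \<open>s + t n * E \<epsilon>\<close>.\<close>
    have "(\<lambda>n. t n * (K - E \<epsilon>)) \<longlonglongrightarrow> 0"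
      using tendsto_mult_right[OF t(2), of "K - E \<epsilon>"] by simp
    then have "\<forall>\<^sub>F n in sequentially. t n * (K - E \<epsilon>) < \<epsilon>"
      using \<epsilon>(1) by (rule order_tendstoD)
    then show ?thesis using near far
    proof eventually_elim
      case (elim n)
      have tn: "t n > 0" by (rule t)
      have "AE x in M. f x \<le> s" unfolding s_def by (rule AE_le_ess_sup[OF nn f])
      moreover have "AE x in M. x \<in> A \<epsilon> \<longrightarrow> h x \<le> E \<epsilon>" using E_iff[OF \<epsilon>(1)] by blast
      ultimately have "AE x in M. u n x \<le> s + t n * (E \<epsilon> + \<bar>e n\<bar>)"
        using elim(2,3) AE_space
      proof eventually_elim
        case (elim x)
        note el = this
        have te: "t n * e n \<le> t n * \<bar>e n\<bar>" "0 \<le> t n * \<bar>e n\<bar>" using tn by (auto intro: mult_left_mono)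
        show ?case
        proof (cases "x \<in> A \<epsilon>")
          case True
          then have "x \<in> near_ess_sup M \<epsilon>0 f" using \<epsilon> by (auto simp: A_def near_ess_sup_def)
          with el(3) have "\<bar>u n x - (f x + t n * h x)\<bar> \<le> t n * e n" by simp
          moreover have "t n * h x \<le> t n * E \<epsilon>" using el(2) True tn by (auto intro: mult_left_mono)
          ultimately show ?thesis using el(1) te unfolding distrib_left by linarith
        next
          case False
          then have "f x < s - \<epsilon>" using el(5) by (auto simp: A_def near_ess_sup_def s_def)
          then show ?thesis
            using el(4) te \<open>t n * (K - E \<epsilon>) < \<epsilon>\<close> unfolding distrib_left right_diff_distrib by linarith
        qed
      qed
      then have "ess_sup M (u n) \<le> s + t n * (E \<epsilon> + \<bar>e n\<bar>)" by (simp add: ess_sup_le_iff[OF nn u])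
      then show ?case using tn by (simp add: q_def field_simps)
    qed
  qed
  have "q \<longlonglongrightarrow> L"
  proof (rule order_tendstoI)
    fix a assume "a < L"
    have "(\<lambda>n. L - e n) \<longlonglongrightarrow> L" using tendsto_diff[OF tendsto_const e, of L] by simp
    then have "\<forall>\<^sub>F n in sequentially. a < L - e n" using \<open>a < L\<close> by (rule order_tendstoD)
    with lower show "\<forall>\<^sub>F n in sequentially. a < q n" by eventually_elim simp
  next
    fix b assume "L < b"
    \<comment> \<open>First \<open>\<epsilon>\<close> is fixed with \<open>E \<epsilon> < b\<close>,
      and only then \<open>n\<close> grows, because the index from which \<open>upper\<close> holds
      depends on \<open>\<epsilon>\<close>.\<close>
    have "\<forall>\<^sub>F \<epsilon> in at_right 0. E \<epsilon> < b"
      unfolding E_def A_def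
      by (rule order_tendstoD(2)[OF tendsto_near_limit[OF nn f h]]) (use \<open>L < b\<close> in \<open>simp add: L_def\<close>)
    moreover have "\<forall>\<^sub>F \<epsilon> in at_right 0. 0 < \<epsilon> \<and> \<epsilon> \<le> \<epsilon>0"
      using \<open>\<epsilon>0 > 0\<close> by (intro eventually_at_rightI[of 0 \<epsilon>0]) auto
    ultimately have "\<forall>\<^sub>F \<epsilon> in at_right 0. E \<epsilon> < b \<and> 0 < \<epsilon> \<and> \<epsilon> \<le> \<epsilon>0"
      by eventually_elim simp
    then obtain \<epsilon> where \<epsilon>: "E \<epsilon> < b" "0 < \<epsilon>" "\<epsilon> \<le> \<epsilon>0"
      using eventually_happens trivial_limit_at_right_real by blast
    have "(\<lambda>n. E \<epsilon> + \<bar>e n\<bar>) \<longlonglongrightarrow> E \<epsilon> + \<bar>0\<bar>"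
      by (intro tendsto_intros e)
    then have "\<forall>\<^sub>F n in sequentially. E \<epsilon> + \<bar>e n\<bar> < b"
      by (rule order_tendstoD) (use \<epsilon> in simp)
    with upper[OF \<epsilon>(2,3)] show "\<forall>\<^sub>F n in sequentially. q n < b" by eventually_elim simp
  qed
  then show ?thesis by (simp add: q_def[abs_def] L_def s_def)
qed

section \<open>Hadamard limits of the functionals on functions\<close>

text \<open>
  The derivative and the limit of the proposed formula \<open>E\<close> are tied together by one witness, so that
  statements about functions transfer both to bounded functions and to classes modulo null sets.
\<close>

definition hadamard_limit ::
  "'a measure \<Rightarrow> (('a \<Rightarrow> real) \<Rightarrow> real) \<Rightarrow> ('a \<Rightarrow> real) \<Rightarrow> ('a \<Rightarrow> real) \<Rightarrow> (real \<Rightarrow> real) \<Rightarrow> bool" where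
  "hadamard_limit M \<phi> f g E \<longleftrightarrow> (\<exists>L. (E \<longlongrightarrow> L) (at_right 0) \<and>
     (\<forall>(t :: nat \<Rightarrow> real) H. (\<forall>n. t n > 0) \<longrightarrow> t \<longlonglongrightarrow> 0 \<longrightarrow> (\<forall>n. H n \<in> ess_bdd M) \<longrightarrow>
        (\<lambda>n. ess_sup M (\<lambda>x. \<bar>H n x - g x\<bar>)) \<longlonglongrightarrow> 0 \<longrightarrow>
        (\<lambda>n. (\<phi> (\<lambda>x. f x + t n * H n x) - \<phi> f) / t n) \<longlonglongrightarrow> L))"

text \<open>Quotients and formulas both subtract termwise; this derives the case of supremum minus
  infimum from the two separate ones.\<close>

lemma hadamard_limit_diff:
  assumes "hadamard_limit M \<phi> f g E" "hadamard_limit M \<phi>' f g E'"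
  shows "hadamard_limit M (\<lambda>u. \<phi> u - \<phi>' u) f g (\<lambda>\<epsilon>. E \<epsilon> - E' \<epsilon>)"
proof -
  from assms obtain L L' where L: "(E \<longlongrightarrow> L) (at_right 0)" "(E' \<longlongrightarrow> L') (at_right 0)"
    and Q: "\<forall>(t :: nat \<Rightarrow> real) H. (\<forall>n. t n > 0) \<longrightarrow> t \<longlonglongrightarrow> 0 \<longrightarrow> (\<forall>n. H n \<in> ess_bdd M) \<longrightarrow>
        (\<lambda>n. ess_sup M (\<lambda>x. \<bar>H n x - g x\<bar>)) \<longlonglongrightarrow> 0 \<longrightarrow>
        (\<lambda>n. (\<phi> (\<lambda>x. f x + t n * H n x) - \<phi> f) / t n) \<longlonglongrightarrow> L"
      "\<forall>(t :: nat \<Rightarrow> real) H. (\<forall>n. t n > 0) \<longrightarrow> t \<longlonglongrightarrow> 0 \<longrightarrow> (\<forall>n. H n \<in> ess_bdd M) \<longrightarrow>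
        (\<lambda>n. ess_sup M (\<lambda>x. \<bar>H n x - g x\<bar>)) \<longlonglongrightarrow> 0 \<longrightarrow>
        (\<lambda>n. (\<phi>' (\<lambda>x. f x + t n * H n x) - \<phi>' f) / t n) \<longlonglongrightarrow> L'"
    unfolding hadamard_limit_def by blast
  have "(\<lambda>n. (\<phi> (\<lambda>x. f x + t n * H n x) - \<phi>' (\<lambda>x. f x + t n * H n x) - (\<phi> f - \<phi>' f)) / t n)
      \<longlonglongrightarrow> L - L'"
    if "\<forall>n. t n > 0" "t \<longlonglongrightarrow> 0" "\<forall>n. H n \<in> ess_bdd M"
      "(\<lambda>n. ess_sup M (\<lambda>x. \<bar>H n x - g x\<bar>)) \<longlonglongrightarrow> 0" for t :: "nat \<Rightarrow> real" and H
  proof -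
    have "(\<lambda>n. (\<phi> (\<lambda>x. f x + t n * H n x) - \<phi> f) / t n -
        (\<phi>' (\<lambda>x. f x + t n * H n x) - \<phi>' f) / t n) \<longlonglongrightarrow> L - L'"
      using Q that by (intro tendsto_diff) blast+
    moreover have "(a - b) / c - (a' - b') / c = (a - a' - (b - b')) / c" for a a' b b' c :: real
      by (simp add: diff_divide_distrib)
    ultimately show ?thesis by simp
  qed
  with L show ?thesis unfolding hadamard_limit_def
    by (intro exI[of _ "L - L'"] conjI tendsto_diff allI impI)
qed

text \<open>The functions \<open>f + t H\<close> and \<open>f + t g\<close> differ a.e. by at most
  \<open>t\<close> times the norm of \<open>H - g\<close>, and this norm serves as the error
  \<open>e\<close>.\<close>

lemma hadamard_limit_ess_sup:
  assumes nn: "emeasure M (space M) \<noteq> 0" and f: "f \<in> ess_bdd M" and g: "g \<in> ess_bdd M"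
  shows "hadamard_limit M (ess_sup M) f g (\<lambda>\<epsilon>. ess_sup_on M (near_ess_sup M \<epsilon> f) g)"
  unfolding hadamard_limit_def
proof (intro exI[of _ "near_limit M f g"] conjI allI impI)
  show "((\<lambda>\<epsilon>. ess_sup_on M (near_ess_sup M \<epsilon> f) g) \<longlongrightarrow> near_limit M f g) (at_right 0)"
    by (rule tendsto_near_limit[OF assms])
next
  fix t :: "nat \<Rightarrow> real" and H
  assume t: "\<forall>n. t n > 0" "t \<longlonglongrightarrow> 0" and H: "\<forall>n. H n \<in> ess_bdd M"
    and e: "(\<lambda>n. ess_sup M (\<lambda>x. \<bar>H n x - g x\<bar>)) \<longlonglongrightarrow> 0"
  define e where "e n = ess_sup M (\<lambda>x. \<bar>H n x - g x\<bar>)" for n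
  have AEe: "AE x in M. \<bar>H n x - g x\<bar> \<le> e n" for n
    unfolding e_def using H g by (intro AE_le_ess_sup nn ess_bdd_abs ess_bdd_diff) auto
  obtain K where K: "AE x in M. \<bar>g x\<bar> \<le> K" using g by (auto simp: ess_bdd_def)
  show "(\<lambda>n. (ess_sup M (\<lambda>x. f x + t n * H n x) - ess_sup M f) / t n) \<longlonglongrightarrow> near_limit M f g"
  \<comment> \<open>The error bound \<open>close\<close> holds a.e. on the whole space, so
    \<open>1\<close> is an arbitrary positive choice for \<open>\<epsilon>0\<close>.
    \<open>K + 1\<close> bounds \<open>H n\<close> a.e. once \<open>e n < 1\<close>.\<close>
  proof (rule ess_sup_quotient_tendsto[OF nn f g _ _ t(2), of _ e 1 "K + 1"])
    show "(\<lambda>x. f x + t n * H n x) \<in> ess_bdd M" for n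
      using H f by (intro ess_bdd_add ess_bdd_scale) auto
    show "t n > 0" for n using t by simp
    show "e \<longlonglongrightarrow> 0" using e by (simp add: e_def[abs_def])
    have close: "AE x in M. \<bar>f x + t n * H n x - (f x + t n * g x)\<bar> \<le> t n * e n" for n
      using AEe[of n]
    proof eventually_elim
      case (elim x)
      have "f x + t n * H n x - (f x + t n * g x) = t n * (H n x - g x)" by (simp add: algebra_simps)
      with elim t(1) show ?case by (simp add: abs_mult abs_of_pos mult_left_mono less_imp_le)
    qed
    show "\<forall>\<^sub>F n in sequentially. AE x in M. x \<in> near_ess_sup M 1 f \<longrightarrow>
        \<bar>f x + t n * H n x - (f x + t n * g x)\<bar> \<le> t n * e n"
    proof (rule always_eventually, rule allI)
      show "AE x in M. x \<in> near_ess_sup M 1 f \<longrightarrow>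
          \<bar>f x + t n * H n x - (f x + t n * g x)\<bar> \<le> t n * e n" for n
        using close[of n] by eventually_elim (rule impI)
    qed
    have "\<forall>\<^sub>F n in sequentially. e n < 1" using \<open>e \<longlonglongrightarrow> 0\<close> by (rule order_tendstoD) simp
    then show "\<forall>\<^sub>F n in sequentially. AE x in M. f x + t n * H n x \<le> f x + t n * (K + 1)"
    proof eventually_elim
      case (elim n)
      show ?case using K AEe[of n]
        by eventually_elim (use t(1) elim in \<open>auto intro!: mult_left_mono less_imp_le\<close>)
    qed
  qed simp
qed

lemma hadamard_limit_ess_inf:
  assumes nn: "emeasure M (space M) \<noteq> 0" and f: "f \<in> ess_bdd M" and g: "g \<in> ess_bdd M"
  shows "hadamard_limit M (ess_inf M) f g (\<lambda>\<epsilon>. ess_inf_on M (near_ess_inf M \<epsilon> f) g)"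
proof -
  let ?E = "\<lambda>\<epsilon>. ess_sup_on M (near_ess_sup M \<epsilon> (\<lambda>x. - f x)) (\<lambda>x. - g x)"
  from hadamard_limit_ess_sup[OF nn ess_bdd_uminus[OF f] ess_bdd_uminus[OF g]]
  obtain L where L: "(?E \<longlongrightarrow> L) (at_right 0)" and
    Q: "\<And>(t :: nat \<Rightarrow> real) H. (\<forall>n. t n > 0) \<Longrightarrow> t \<longlonglongrightarrow> 0 \<Longrightarrow> (\<forall>n. H n \<in> ess_bdd M) \<Longrightarrow>
        (\<lambda>n. ess_sup M (\<lambda>x. \<bar>H n x - (- g x)\<bar>)) \<longlonglongrightarrow> 0 \<Longrightarrow>
        (\<lambda>n. (ess_sup M (\<lambda>x. - f x + t n * H n x) - ess_sup M (\<lambda>x. - f x)) / t n) \<longlonglongrightarrow> L"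
    unfolding hadamard_limit_def by blast
  show ?thesis
    unfolding hadamard_limit_def
  proof (intro exI[of _ "- L"] conjI allI impI)
    show "((\<lambda>\<epsilon>. ess_inf_on M (near_ess_inf M \<epsilon> f) g) \<longlongrightarrow> - L) (at_right 0)"
      using tendsto_minus[OF L] by (simp add: ess_inf_on_eq near_ess_inf_eq)
  next
    fix t :: "nat \<Rightarrow> real" and H
    assume t: "\<forall>n. t n > 0" "t \<longlonglongrightarrow> 0" and H: "\<forall>n. H n \<in> ess_bdd M"
      and e: "(\<lambda>n. ess_sup M (\<lambda>x. \<bar>H n x - g x\<bar>)) \<longlonglongrightarrow> 0"
    \<comment> \<open>The sequence \<open>- H n\<close> approaches \<open>- g\<close> at the same
      distances, so \<open>Q\<close> applies to it.\<close>
    have "\<bar>- H n x - - g x\<bar> = \<bar>H n x - g x\<bar>" for n x by simp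
    then have "(\<lambda>n. (ess_sup M (\<lambda>x. - f x + t n * (- H n x)) - ess_sup M (\<lambda>x. - f x)) / t n) \<longlonglongrightarrow> L"
      using H e by (intro Q t) (auto intro: ess_bdd_uminus)
    then have "(\<lambda>n. - ((ess_sup M (\<lambda>x. - f x + t n * (- H n x)) - ess_sup M (\<lambda>x. - f x)) / t n)) \<longlonglongrightarrow> - L"
      by (rule tendsto_minus)
    then show "(\<lambda>n. (ess_inf M (\<lambda>x. f x + t n * H n x) - ess_inf M f) / t n) \<longlonglongrightarrow> - L"
      by (simp add: ess_inf_on_eq minus_divide_left)
  qed
qed

text \<open>
  On a set where \<open>\<bar>f\<bar>\<close> is bounded away from \<open>0\<close>, a small perturbation does not change the sign
  of \<open>f\<close>, so \<open>\<bar>f + t H\<bar> = \<bar>f\<bar> + t H sgn f\<close> there.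
\<close>

lemma hadamard_limit_ess_norm:
  assumes nz: "\<not> (AE x in M. f x = 0)" and f: "f \<in> ess_bdd M" and g: "g \<in> ess_bdd M"
  shows "hadamard_limit M (\<lambda>u. ess_sup M (\<lambda>x. \<bar>u x\<bar>)) f g
     (\<lambda>\<epsilon>. ess_sup_on M (near_ess_sup M \<epsilon> (\<lambda>x. \<bar>f x\<bar>)) (\<lambda>x. g x * sgn (f x)))"
proof -
  have nn: "emeasure M (space M) \<noteq> 0"
    using nz by (rule nonnull_if_not_AE)
  define s where "s = ess_sup M (\<lambda>x. \<bar>f x\<bar>)"
  \<comment> \<open>Here \<open>f\<close> not being a.e. zero becomes \<open>s > 0\<close>, the room
    that the sign argument needs.\<close>
  have "\<not> s \<le> 0"
    unfolding s_def ess_sup_le_iff[OF nn ess_bdd_abs[OF f]] using nz by simp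
  then have s: "s > 0" by simp
  note abs_f = ess_bdd_abs[OF f] and sgn_g = ess_bdd_mult_sgn[OF f g]
  show ?thesis
    unfolding hadamard_limit_def
  proof (intro exI[of _ "near_limit M (\<lambda>x. \<bar>f x\<bar>) (\<lambda>x. g x * sgn (f x))"] conjI allI impI)
    show "((\<lambda>\<epsilon>. ess_sup_on M (near_ess_sup M \<epsilon> (\<lambda>x. \<bar>f x\<bar>)) (\<lambda>x. g x * sgn (f x)))
        \<longlongrightarrow> near_limit M (\<lambda>x. \<bar>f x\<bar>) (\<lambda>x. g x * sgn (f x))) (at_right 0)"
      by (rule tendsto_near_limit[OF nn abs_f sgn_g])
  next
    fix t :: "nat \<Rightarrow> real" and H
    assume t: "\<forall>n. t n > 0" "t \<longlonglongrightarrow> 0" and H: "\<forall>n. H n \<in> ess_bdd M"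
      and e: "(\<lambda>n. ess_sup M (\<lambda>x. \<bar>H n x - g x\<bar>)) \<longlonglongrightarrow> 0"
    define e where "e n = ess_sup M (\<lambda>x. \<bar>H n x - g x\<bar>)" for n
    have AEe: "AE x in M. \<bar>H n x - g x\<bar> \<le> e n" for n
      unfolding e_def using H g by (intro AE_le_ess_sup nn ess_bdd_abs ess_bdd_diff) auto
    have e0: "e \<longlonglongrightarrow> 0" using e by (simp add: e_def[abs_def])
    obtain K where K: "AE x in M. \<bar>g x\<bar> \<le> K" using g by (auto simp: ess_bdd_def)
    have "\<forall>\<^sub>F n in sequentially. e n < 1" using e0 by (rule order_tendstoD) simp
    then have H_bd: "\<forall>\<^sub>F n in sequentially. AE x in M. \<bar>H n x\<bar> \<le> K + 1"
    proof eventually_elim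
      case (elim n)
      show ?case using K AEe[of n] by eventually_elim (use elim in auto)
    qed
    show "(\<lambda>n. (ess_sup M (\<lambda>x. \<bar>f x + t n * H n x\<bar>) - ess_sup M (\<lambda>x. \<bar>f x\<bar>)) / t n)
        \<longlonglongrightarrow> near_limit M (\<lambda>x. \<bar>f x\<bar>) (\<lambda>x. g x * sgn (f x))"
    \<comment> \<open>With \<open>\<epsilon>0 = s / 2\<close>, the near set satisfies
      \<open>\<bar>f x\<bar> \<ge> s / 2\<close>. \<open>K + 1\<close> bounds
      \<open>\<bar>H n\<bar>\<close> a.e. for large \<open>n\<close> by \<open>H_bd\<close>.\<close>
    proof (rule ess_sup_quotient_tendsto[OF nn abs_f sgn_g _ _ t(2) e0, of _ "s / 2" "K + 1"])
      show "(\<lambda>x. \<bar>f x + t n * H n x\<bar>) \<in> ess_bdd M" for n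
        using H f by (intro ess_bdd_abs ess_bdd_add ess_bdd_scale) auto
      show "t n > 0" for n using t by simp
      show "s / 2 > 0" using s by simp
      show "\<forall>\<^sub>F n in sequentially. AE x in M. \<bar>f x + t n * H n x\<bar> \<le> \<bar>f x\<bar> + t n * (K + 1)"
        using H_bd
      proof eventually_elim
        case (elim n)
        then show ?case
        proof eventually_elim
          case (elim x)
          have "\<bar>t n * H n x\<bar> \<le> t n * (K + 1)"
            using elim t(1) by (simp add: abs_mult abs_of_pos mult_left_mono less_imp_le)
          then show ?case by linarith
        qed
      qed
      \<comment> \<open>Once \<open>t n * (K + 1) < s / 2\<close>, the perturbation is smaller than
        \<open>\<bar>f x\<bar>\<close> on the near set.\<close>
      have "(\<lambda>n. t n * (K + 1)) \<longlonglongrightarrow> 0"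
        using tendsto_mult_right[OF t(2), of "K + 1"] by simp
      then have "\<forall>\<^sub>F n in sequentially. t n * (K + 1) < s / 2"
        by (rule order_tendstoD) (use s in simp)
      then show "\<forall>\<^sub>F n in sequentially. AE x in M. x \<in> near_ess_sup M (s / 2) (\<lambda>x. \<bar>f x\<bar>) \<longrightarrow>
          \<bar>\<bar>f x + t n * H n x\<bar> - (\<bar>f x\<bar> + t n * (g x * sgn (f x)))\<bar> \<le> t n * e n"
        using H_bd
      proof eventually_elim
        case (elim n)
        note small = elim(1)
        show ?case using elim(2) AEe[of n]
        proof (eventually_elim, intro impI)
          fix x assume Hx: "\<bar>H n x\<bar> \<le> K + 1" and ex: "\<bar>H n x - g x\<bar> \<le> e n"
            and x: "x \<in> near_ess_sup M (s / 2) (\<lambda>x. \<bar>f x\<bar>)"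
          from x have fx: "\<bar>f x\<bar> \<ge> s / 2" by (auto simp: near_ess_sup_def s_def)
          have tn: "t n > 0" using t by simp
          have tH: "\<bar>t n * H n x\<bar> \<le> t n * (K + 1)"
            using Hx tn by (simp add: abs_mult mult_left_mono)
          have te: "\<bar>t n * H n x - t n * g x\<bar> \<le> t n * e n"
            using ex tn by (simp add: abs_mult mult_left_mono flip: right_diff_distrib)
          show "\<bar>\<bar>f x + t n * H n x\<bar> - (\<bar>f x\<bar> + t n * (g x * sgn (f x)))\<bar> \<le> t n * e n"
          proof (cases "f x > 0")
            case True
            then have "\<bar>f x + t n * H n x\<bar> = f x + t n * H n x" using tH fx small by linarith
            with True te show ?thesis by simp
          next
            case False
            then have "f x < 0" using fx s by linarith
            then have "\<bar>f x + t n * H n x\<bar> = - f x - t n * H n x" using tH fx small by linarith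
            with \<open>f x < 0\<close> te show ?thesis by simp
          qed
        qed
      qed
    qed
  qed
qed

section \<open>Transfer to classes modulo null sets\<close>

lemma has_hadamard_deriv_real_iff:
  fixes \<phi> :: "'v \<Rightarrow> real"
  shows "has_hadamard_deriv V D0 \<phi> \<theta> \<phi>' \<longleftrightarrow> (\<forall>h\<in>D0. \<forall>(t :: nat \<Rightarrow> real) H.
       (\<forall>n. t n > 0) \<longrightarrow> t \<longlonglongrightarrow> 0 \<longrightarrow>
       (\<forall>n. H n \<in> vcarrier V) \<longrightarrow> (\<lambda>n. vnorm V (vdiff V (H n) h)) \<longlonglongrightarrow> 0 \<longrightarrow>
       (\<lambda>n. (\<phi> (vadd V \<theta> (vscale V (t n) (H n))) - \<phi> \<theta>) / t n) \<longlonglongrightarrow> \<phi>' h)"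
proof -
  have "(\<lambda>n. norm (a n /\<^sub>R t n - L)) \<longlonglongrightarrow> 0 \<longleftrightarrow> (\<lambda>n. a n / t n) \<longlonglongrightarrow> L"
    for a t :: "nat \<Rightarrow> real" and L
    unfolding tendsto_norm_zero_iff LIM_zero_iff real_scaleR_def divide_inverse_commute ..
  then show ?thesis by (simp only: has_hadamard_deriv_def)
qed

lemma Linf_repr:
  assumes "F \<in> vcarrier (Linf M)" "f \<in> F"
  shows "f \<in> ess_bdd M" "F = ae_rel M `` {f}"
proof -
  from assms obtain f0 where "f0 \<in> ess_bdd M" "F = ae_rel M `` {f0}"
    by (auto simp: Linf_def elim: quotientE)
  with assms(2) equiv_class_eq[OF equiv_ae_rel, of f0 f M]
  show "f \<in> ess_bdd M" "F = ae_rel M `` {f}" by (auto simp: ae_rel_def)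
qed

lemma Linf_ex_repr:
  assumes "F \<in> vcarrier (Linf M)" shows "\<exists>f. f \<in> F"
  using assms equiv_class_self[OF equiv_ae_rel] by (force simp: Linf_def elim: quotientE)

lemma Linf_not_AE_zero:
  assumes "F \<in> vcarrier (Linf M) - {vzero (Linf M)}" "f \<in> F"
  shows "\<not> (AE x in M. f x = 0)"
proof
  assume ae: "AE x in M. f x = 0"
  note f = Linf_repr[OF DiffD1[OF assms(1)] assms(2)]
  moreover have "(\<lambda>x. 0) \<in> ess_bdd M" by (auto simp: ess_bdd_def)
  ultimately have "(f, \<lambda>x. 0) \<in> ae_rel M" using ae by (simp add: ae_rel_def)
  then have "F = vzero (Linf M)"
    using equiv_class_eq[OF equiv_ae_rel] f(2) by (simp add: Linf_def)
  with assms(1) show False by simp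
qed

text \<open>
  All representatives yield the same derivative because the difference quotients of the
  functional on classes do not see the representatives and limits are unique.
\<close>

lemma has_hadamard_deriv_Linf:
  assumes F: "F \<in> vcarrier (Linf M) - {vzero (Linf M)}"
    and lim: "\<And>f g. \<not> (AE x in M. f x = 0) \<Longrightarrow> f \<in> ess_bdd M \<Longrightarrow> g \<in> ess_bdd M \<Longrightarrow>
      hadamard_limit M \<phi> f g (E f g)"
    and \<Phi>: "\<And>u. u \<in> ess_bdd M \<Longrightarrow> \<Phi> (ae_rel M `` {u}) = \<phi> u"
  shows "\<exists>\<delta>'. has_hadamard_deriv (Linf M) (vcarrier (Linf M)) \<Phi> F \<delta>' \<and>
    (\<forall>G \<in> vcarrier (Linf M). \<forall>f\<in>F. \<forall>g\<in>G. (E f g \<longlongrightarrow> \<delta>' G) (at_right 0))"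
proof -
  \<comment> \<open>\<open>P G L\<close> mentions classes only, so limits obtained from different
    representatives can be compared through it.\<close>
  define P where "P G L \<longleftrightarrow> (\<forall>(t :: nat \<Rightarrow> real) H.
       (\<forall>n. t n > 0) \<longrightarrow> t \<longlonglongrightarrow> 0 \<longrightarrow> (\<forall>n. H n \<in> vcarrier (Linf M)) \<longrightarrow>
       (\<lambda>n. vnorm (Linf M) (vdiff (Linf M) (H n) G)) \<longlonglongrightarrow> 0 \<longrightarrow>
       (\<lambda>n. (\<Phi> (vadd (Linf M) F (vscale (Linf M) (t n) (H n))) - \<Phi> F) / t n) \<longlonglongrightarrow> L)" for G L
  have FC: "F \<in> vcarrier (Linf M)" using F by simp
  have norm_diff: "vnorm (Linf M) (vdiff (Linf M) (ae_rel M `` {h}) (ae_rel M `` {g})) =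
      ess_sup M (\<lambda>x. \<bar>h x - g x\<bar>)" if "h \<in> ess_bdd M" "g \<in> ess_bdd M" for g h
    using that ess_bdd_uminus[OF that(2)] ess_bdd_add[OF that(1) ess_bdd_uminus[OF that(2)]]
    by (simp add: vdiff_def vadd_Linf_class vscale_Linf_class vnorm_Linf_class)
  have ex: "\<exists>L. (E f g \<longlongrightarrow> L) (at_right 0) \<and> P G L"
    if G: "G \<in> vcarrier (Linf M)" and "f \<in> F" "g \<in> G" for f g G
  proof -
    note f = Linf_repr[OF FC \<open>f \<in> F\<close>] and g = Linf_repr[OF G \<open>g \<in> G\<close>]
    obtain L where L: "(E f g \<longlongrightarrow> L) (at_right 0)" and
      Q: "\<And>(t :: nat \<Rightarrow> real) H. (\<forall>n. t n > 0) \<Longrightarrow> t \<longlonglongrightarrow> 0 \<Longrightarrow> (\<forall>n. H n \<in> ess_bdd M) \<Longrightarrow>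
        (\<lambda>n. ess_sup M (\<lambda>x. \<bar>H n x - g x\<bar>)) \<longlonglongrightarrow> 0 \<Longrightarrow>
        (\<lambda>n. (\<phi> (\<lambda>x. f x + t n * H n x) - \<phi> f) / t n) \<longlonglongrightarrow> L"
      using lim[OF Linf_not_AE_zero[OF F \<open>f \<in> F\<close>] f(1) g(1)] unfolding hadamard_limit_def by blast
    have "P G L"
      unfolding P_def
    proof (intro allI impI)
      fix t :: "nat \<Rightarrow> real" and H
      assume t: "\<forall>n. t n > 0" "t \<longlonglongrightarrow> 0" and H: "\<forall>n. H n \<in> vcarrier (Linf M)"
        and e: "(\<lambda>n. vnorm (Linf M) (vdiff (Linf M) (H n) G)) \<longlonglongrightarrow> 0"
      \<comment> \<open>A sequence of classes is lifted by choosing a representative of each term;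
        the quotients of \<open>\<Phi>\<close> then equal those of \<open>\<phi>\<close>.\<close>
      have "\<forall>n. \<exists>h. h \<in> H n" using H Linf_ex_repr by blast
      then obtain h where "\<And>n. h n \<in> H n" by metis
      then have h: "h n \<in> ess_bdd M" "H n = ae_rel M `` {h n}" for n
        using Linf_repr H by blast+
      have "(\<lambda>n. (\<phi> (\<lambda>x. f x + t n * h n x) - \<phi> f) / t n) \<longlonglongrightarrow> L"
        using e h g f by (intro Q t) (simp_all add: norm_diff)
      moreover have "\<Phi> (vadd (Linf M) F (vscale (Linf M) (t n) (H n))) = \<phi> (\<lambda>x. f x + t n * h n x)" for n
        by (simp add: f h vscale_Linf_class vadd_Linf_class \<Phi> ess_bdd_scale ess_bdd_add)
      moreover have "\<Phi> F = \<phi> f" using f \<Phi> by simp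
      ultimately show "(\<lambda>n. (\<Phi> (vadd (Linf M) F (vscale (Linf M) (t n) (H n))) - \<Phi> F) / t n) \<longlonglongrightarrow> L"
        by simp
    qed
    with L show ?thesis by blast
  qed
  obtain f0 where f0: "f0 \<in> F" using Linf_ex_repr[OF FC] by blast
  \<comment> \<open>On a null space even the essential supremum of the constant \<open>0\<close> is
    unspecified; \<open>nn\<close> makes it \<open>0\<close>, so that \<open>G\<close> has distance
    \<open>0\<close> from itself.\<close>
  have nn: "emeasure M (space M) \<noteq> 0"
    using Linf_not_AE_zero[OF F f0] by (rule nonnull_if_not_AE)
  have unique: "L = L'" if G: "G \<in> vcarrier (Linf M)" and P: "P G L" "P G L'" for G L L'
  proof -
    obtain g where "g \<in> G" using Linf_ex_repr[OF G] by blast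
    note g = Linf_repr[OF G this]
    have z: "(\<lambda>x. 0) \<in> ess_bdd M" by (auto simp: ess_bdd_def)
    have "ess_sup M (\<lambda>x. 0) = 0"
      by (rule antisym) (use ess_sup_le_iff[OF nn z, of 0] ess_sup_on_ge[OF sets.top nn z] in auto)
    then have "vnorm (Linf M) (vdiff (Linf M) G G) = 0"
      using norm_diff[OF g(1) g(1)] g(2) by simp
    \<comment> \<open>One admissible pair, \<open>1 / Suc n\<close> with the constant sequence
      \<open>G\<close>, already determines the limit.\<close>
    then have "(\<lambda>n. (\<Phi> (vadd (Linf M) F (vscale (Linf M) (1 / real (Suc n)) G)) - \<Phi> F) / (1 / real (Suc n))) \<longlonglongrightarrow> L''"
      if "P G L''" for L''
      using that G LIMSEQ_inverse_real_of_nat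
      unfolding P_def by (elim allE[of _ "\<lambda>n. 1 / real (Suc n)"] allE[of _ "\<lambda>_. G"])
        (simp add: inverse_eq_divide)
    from this[OF P(1)] this[OF P(2)] show ?thesis by (rule LIMSEQ_unique)
  qed
  \<comment> \<open>For \<open>G\<close> in the carrier, \<open>ex\<close> and \<open>unique\<close>
    give exactly one \<open>L\<close> with \<open>P G L\<close>, so \<open>D G\<close> is the limit
    of \<open>E f g\<close> for every choice of representatives.\<close>
  define D where "D G = (THE L. P G L)" for G
  have D: "D G = L" if "G \<in> vcarrier (Linf M)" "P G L" for G L
    unfolding D_def using that unique by blast
  show ?thesis
  proof (intro exI[of _ D] conjI ballI)
    show "(E f g \<longlongrightarrow> D G) (at_right 0)" if "G \<in> vcarrier (Linf M)" "f \<in> F" "g \<in> G" for G f g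
      using ex[OF that] D[OF that(1)] by blast
    have "P G (D G)" if G: "G \<in> vcarrier (Linf M)" for G
      using ex[OF G f0] Linf_ex_repr[OF G] D[OF G] by blast
    then show "has_hadamard_deriv (Linf M) (vcarrier (Linf M)) \<Phi> F D"
      unfolding has_hadamard_deriv_real_iff P_def by blast
  qed
qed

section \<open>Bounded functions through the counting measure\<close>

text \<open>Only the empty set is null, so the constants in the infimum are exactly the upper bounds
  of \<open>u\<close> on \<open>A\<close>; for nonempty \<open>A\<close> the least of them is the
  supremum.\<close>

lemma ess_sup_on_count_space:
  assumes u: "u \<in> ess_bdd (count_space X)" and A: "A \<subseteq> X" "A \<noteq> {}"
  shows "ess_sup_on (count_space X) A u = (SUP x\<in>A. u x)"
proof -
  obtain C where C: "\<forall>x\<in>X. \<bar>u x\<bar> \<le> C" using u by (auto simp: ess_bdd_def AE_count_space)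
  then have bdd: "bdd_above (u ` A)" using A by (intro bdd_aboveI2[of _ _ C]) force
  have "emeasure (count_space X) {x\<in>A. u x > c} = 0 \<longleftrightarrow> (\<forall>x\<in>A. u x \<le> c)" for c
    using A by (subst emeasure_count_space_eq_0) auto
  then show ?thesis
    unfolding ess_sup_on_def using A bdd
    by (intro cInf_eq_minimum) (auto intro: cSUP_upper cSUP_least)
qed

lemma ess_inf_on_count_space:
  assumes u: "u \<in> ess_bdd (count_space X)" and A: "A \<subseteq> X" "A \<noteq> {}"
  shows "ess_inf_on (count_space X) A u = (INF x\<in>A. u x)"
  using ess_sup_on_count_space[OF ess_bdd_uminus[OF u] A]
  by (simp add: ess_inf_on_eq Inf_real_def image_image)

lemma near_sup_count_space:
  assumes u: "u \<in> ess_bdd (count_space X)" and "X \<noteq> {}"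
  shows "near_ess_sup (count_space X) \<epsilon> u = near_sup X \<epsilon> u"
  using ess_sup_on_count_space[OF u order_refl] assms by (simp add: near_ess_sup_def near_sup_def)

lemma near_inf_count_space:
  assumes u: "u \<in> ess_bdd (count_space X)" and "X \<noteq> {}"
  shows "near_ess_inf (count_space X) \<epsilon> u = near_inf X \<epsilon> u"
  using ess_inf_on_count_space[OF u order_refl] assms by (simp add: near_ess_inf_def near_inf_def)

lemma nonnull_count_space: "X \<noteq> {} \<Longrightarrow> emeasure (count_space X) (space (count_space X)) \<noteq> 0"
  by (simp add: emeasure_count_space_eq_0)

text \<open>Non-null means nonempty for the counting measure. Nonemptiness is what the agreement of
  essential and ordinary suprema over these sets requires.\<close>

lemma near_sup_nonempty:
  assumes u: "u \<in> ess_bdd (count_space X)" and "X \<noteq> {}" "\<epsilon> > 0"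
  shows "near_sup X \<epsilon> u \<noteq> {}"
  using near_ess_sup_nonnull[OF nonnull_count_space[OF assms(2)] u assms(3)]
  by (auto simp: near_sup_count_space[OF u assms(2)])

lemma near_inf_nonempty:
  assumes u: "u \<in> ess_bdd (count_space X)" and "X \<noteq> {}" "\<epsilon> > 0"
  shows "near_inf X \<epsilon> u \<noteq> {}"
  using near_ess_sup_nonnull[OF nonnull_count_space[OF assms(2)] ess_bdd_uminus[OF u] assms(3)]
  by (auto simp: near_inf_count_space[OF u assms(2)] simp flip: near_ess_inf_eq)

lemma near_sup_ess_sup_on_count_space:
  assumes u: "u \<in> ess_bdd (count_space X)" and g: "g \<in> ess_bdd (count_space X)"
    and "X \<noteq> {}" "\<epsilon> > 0"
  shows "ess_sup_on (count_space X) (near_ess_sup (count_space X) \<epsilon> u) g = (SUP x\<in>near_sup X \<epsilon> u. g x)"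
  unfolding near_sup_count_space[OF u assms(3)]
  using near_sup_nonempty[OF u assms(3,4)]
  by (intro ess_sup_on_count_space[OF g]) (auto simp: near_sup_def)

lemma near_inf_ess_inf_on_count_space:
  assumes u: "u \<in> ess_bdd (count_space X)" and g: "g \<in> ess_bdd (count_space X)"
    and "X \<noteq> {}" "\<epsilon> > 0"
  shows "ess_inf_on (count_space X) (near_ess_inf (count_space X) \<epsilon> u) g = (INF x\<in>near_inf X \<epsilon> u. g x)"
  unfolding near_inf_count_space[OF u assms(3)]
  using near_inf_nonempty[OF u assms(3,4)]
  by (intro ess_inf_on_count_space[OF g]) (auto simp: near_inf_def)

lemma linf_ess_bdd: "f \<in> vcarrier (linf X) \<Longrightarrow> f \<in> ess_bdd (count_space X)"
  by (auto simp: linf_def ess_bdd_def bounded_iff AE_count_space)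

text \<open>For the counting measure a.e. means everywhere on \<open>X\<close>, and off
  \<open>X\<close> both functions are \<open>undefined\<close>.\<close>

lemma linf_not_AE_zero:
  "f \<in> vcarrier (linf X) - {vzero (linf X)} \<Longrightarrow> \<not> (AE x in count_space X. f x = 0)"
  by (auto simp: linf_def AE_count_space intro!: extensionalityI)

text \<open>\<open>\<phi>\<close> is evaluated at functions on the whole type, \<open>\<Phi>\<close>
  at functions that are \<open>undefined\<close> off \<open>X\<close>; \<open>restrict\<close> links
  them. \<open>E\<close> is the formula with essential suprema or infima, \<open>E'\<close> the one
  with ordinary ones.\<close>

lemma has_hadamard_deriv_linf:
  assumes X: "X \<noteq> {}" and f: "f \<in> vcarrier (linf X)"
    and lim: "\<And>g. g \<in> ess_bdd (count_space X) \<Longrightarrow> hadamard_limit (count_space X) \<phi> f g (E g)"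
    and \<Phi>: "\<And>u. u \<in> ess_bdd (count_space X) \<Longrightarrow> \<Phi> (restrict u X) = \<phi> u"
    and E: "\<And>g \<epsilon>. g \<in> ess_bdd (count_space X) \<Longrightarrow> \<epsilon> > 0 \<Longrightarrow> E g \<epsilon> = E' g \<epsilon>"
  shows "\<exists>\<delta>'. has_hadamard_deriv (linf X) (vcarrier (linf X)) \<Phi> f \<delta>' \<and>
    (\<forall>g \<in> vcarrier (linf X). (E' g \<longlongrightarrow> \<delta>' g) (at_right 0))"
proof -
  let ?M = "count_space X"
  let ?deriv = "\<lambda>g L. (E' g \<longlongrightarrow> L) (at_right 0) \<and>
     (\<forall>(t :: nat \<Rightarrow> real) H. (\<forall>n. t n > 0) \<longrightarrow> t \<longlonglongrightarrow> 0 \<longrightarrow> (\<forall>n. H n \<in> vcarrier (linf X)) \<longrightarrow>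
       (\<lambda>n. vnorm (linf X) (vdiff (linf X) (H n) g)) \<longlonglongrightarrow> 0 \<longrightarrow>
       (\<lambda>n. (\<Phi> (vadd (linf X) f (vscale (linf X) (t n) (H n))) - \<Phi> f) / t n) \<longlonglongrightarrow> L)"
  have "\<exists>L. ?deriv g L"
    if g: "g \<in> vcarrier (linf X)" for g
  proof -
    obtain L where L: "(E g \<longlongrightarrow> L) (at_right 0)" and
      Q: "\<And>(t :: nat \<Rightarrow> real) H. (\<forall>n. t n > 0) \<Longrightarrow> t \<longlonglongrightarrow> 0 \<Longrightarrow> (\<forall>n. H n \<in> ess_bdd ?M) \<Longrightarrow>
        (\<lambda>n. ess_sup ?M (\<lambda>x. \<bar>H n x - g x\<bar>)) \<longlonglongrightarrow> 0 \<Longrightarrow>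
        (\<lambda>n. (\<phi> (\<lambda>x. f x + t n * H n x) - \<phi> f) / t n) \<longlonglongrightarrow> L"
      using lim[OF linf_ess_bdd[OF g]] unfolding hadamard_limit_def by blast
    \<comment> \<open>For a limit from the right, agreement at positive \<open>\<epsilon>\<close>
      suffices; for other values the near sets may be empty.\<close>
    have "\<forall>\<^sub>F \<epsilon> in at_right 0. E g \<epsilon> = E' g \<epsilon>"
      using E[OF linf_ess_bdd[OF g]] by (intro eventually_at_rightI[of 0 1]) auto
    then have "(E' g \<longlongrightarrow> L) (at_right 0)" using L by (simp cong: tendsto_cong)
    moreover have "(\<lambda>n. (\<Phi> (vadd (linf X) f (vscale (linf X) (t n) (H n))) - \<Phi> f) / t n) \<longlonglongrightarrow> L"
      if t: "\<forall>n. t n > 0" "t \<longlonglongrightarrow> 0" and H: "\<forall>n. H n \<in> vcarrier (linf X)"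
        and e: "(\<lambda>n. vnorm (linf X) (vdiff (linf X) (H n) g)) \<longlonglongrightarrow> 0" for t :: "nat \<Rightarrow> real" and H
    proof -
      have Hb: "H n \<in> ess_bdd ?M" for n using H linf_ess_bdd by blast
      have "vnorm (linf X) (vdiff (linf X) (H n) g) = ess_sup ?M (\<lambda>x. \<bar>H n x - g x\<bar>)" for n
      proof -
        have "ess_sup ?M (\<lambda>x. \<bar>H n x - g x\<bar>) = (SUP x\<in>X. \<bar>H n x - g x\<bar>)"
          using ess_sup_on_count_space[OF ess_bdd_abs[OF ess_bdd_diff[OF Hb linf_ess_bdd[OF g]]]] X
          by simp
        also have "\<dots> = vnorm (linf X) (vdiff (linf X) (H n) g)"
          by (auto simp: linf_def vdiff_def intro!: SUP_cong)
        finally show ?thesis by simp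
      qed
      then have "(\<lambda>n. (\<phi> (\<lambda>x. f x + t n * H n x) - \<phi> f) / t n) \<longlonglongrightarrow> L"
        using e Hb by (intro Q t) simp_all
      moreover have "\<Phi> (vadd (linf X) f (vscale (linf X) (t n) (H n))) = \<phi> (\<lambda>x. f x + t n * H n x)" for n
      proof -
        have "vadd (linf X) f (vscale (linf X) (t n) (H n)) = restrict (\<lambda>x. f x + t n * H n x) X"
          by (auto simp: linf_def)
        then show ?thesis
          using \<Phi> ess_bdd_add[OF linf_ess_bdd[OF f] ess_bdd_scale[OF Hb]] by simp
      qed
      moreover have "\<Phi> f = \<phi> f"
      proof -
        have "restrict f X = f" using f by (auto simp: linf_def intro: extensional_restrict)
        then show ?thesis using \<Phi>[OF linf_ess_bdd[OF f]] by simp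
      qed
      ultimately show ?thesis by simp
    qed
    ultimately show ?thesis by blast
  qed
  then have "\<forall>g\<in>vcarrier (linf X). \<exists>L. ?deriv g L" by (intro ballI)
  \<comment> \<open>Each \<open>g\<close> is its own representative, so choosing one limit per
    \<open>g\<close> defines the derivative.\<close>
  from bchoice[OF this] obtain D where D: "\<forall>g\<in>vcarrier (linf X). ?deriv g (D g)" ..
  then have "has_hadamard_deriv (linf X) (vcarrier (linf X)) \<Phi> f D"
    unfolding has_hadamard_deriv_real_iff by (intro ballI) (drule bspec, assumption, erule conjunct2)
  with D show ?thesis by blast
qed

section \<open>The four functionals in both settings\<close>

theorem theorem2p1:
  fixes X :: "'a set"
  assumes "X \<noteq> {}"
  shows
   "(\<forall>f \<in> vcarrier (linf X) - {vzero (linf X)}.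
      (\<exists>\<delta>'. has_hadamard_deriv (linf X) (vcarrier (linf X)) (vnorm (linf X)) f \<delta>' \<and>
         (\<forall>g \<in> vcarrier (linf X).
            ((\<lambda>\<epsilon>. SUP x \<in> near_sup X \<epsilon> (\<lambda>x. \<bar>f x\<bar>). g x * sgn (f x)) \<longlongrightarrow> \<delta>' g) (at_right 0))) \<and>
      (\<exists>\<sigma>'. has_hadamard_deriv (linf X) (vcarrier (linf X)) (\<lambda>u. SUP x \<in> X. u x) f \<sigma>' \<and>
         (\<forall>g \<in> vcarrier (linf X).
            ((\<lambda>\<epsilon>. SUP x \<in> near_sup X \<epsilon> f. g x) \<longlongrightarrow> \<sigma>' g) (at_right 0))) \<and>
      (\<exists>\<iota>'. has_hadamard_deriv (linf X) (vcarrier (linf X)) (\<lambda>u. INF x \<in> X. u x) f \<iota>' \<and>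
         (\<forall>g \<in> vcarrier (linf X).
            ((\<lambda>\<epsilon>. INF x \<in> near_inf X \<epsilon> f. g x) \<longlongrightarrow> \<iota>' g) (at_right 0))) \<and>
      (\<exists>\<alpha>'. has_hadamard_deriv (linf X) (vcarrier (linf X))
               (\<lambda>u. (SUP x \<in> X. u x) - (INF x \<in> X. u x)) f \<alpha>' \<and>
         (\<forall>g \<in> vcarrier (linf X).
            ((\<lambda>\<epsilon>. (SUP x \<in> near_sup X \<epsilon> f. g x) - (INF x \<in> near_inf X \<epsilon> f. g x)) \<longlongrightarrow> \<alpha>' g)
              (at_right 0)))) \<and>
    (\<forall>M :: 'a measure. space M = X \<longrightarrow>
      (\<forall>F \<in> vcarrier (Linf M) - {vzero (Linf M)}.
        (\<exists>\<delta>'. has_hadamard_deriv (Linf M) (vcarrier (Linf M)) (vnorm (Linf M)) F \<delta>' \<and>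
           (\<forall>G \<in> vcarrier (Linf M). \<forall>f\<in>F. \<forall>g\<in>G.
              ((\<lambda>\<epsilon>. ess_sup_on M (near_ess_sup M \<epsilon> (\<lambda>x. \<bar>f x\<bar>)) (\<lambda>x. g x * sgn (f x))) \<longlongrightarrow> \<delta>' G)
                (at_right 0))) \<and>
        (\<exists>\<sigma>'. has_hadamard_deriv (Linf M) (vcarrier (Linf M)) (on_class (ess_sup M)) F \<sigma>' \<and>
           (\<forall>G \<in> vcarrier (Linf M). \<forall>f\<in>F. \<forall>g\<in>G.
              ((\<lambda>\<epsilon>. ess_sup_on M (near_ess_sup M \<epsilon> f) g) \<longlongrightarrow> \<sigma>' G) (at_right 0))) \<and>
        (\<exists>\<iota>'. has_hadamard_deriv (Linf M) (vcarrier (Linf M)) (on_class (ess_inf M)) F \<iota>' \<and>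
           (\<forall>G \<in> vcarrier (Linf M). \<forall>f\<in>F. \<forall>g\<in>G.
              ((\<lambda>\<epsilon>. ess_inf_on M (near_ess_inf M \<epsilon> f) g) \<longlongrightarrow> \<iota>' G) (at_right 0))) \<and>
        (\<exists>\<alpha>'. has_hadamard_deriv (Linf M) (vcarrier (Linf M))
                 (on_class (\<lambda>u. ess_sup M u - ess_inf M u)) F \<alpha>' \<and>
           (\<forall>G \<in> vcarrier (Linf M). \<forall>f\<in>F. \<forall>g\<in>G.
              ((\<lambda>\<epsilon>. ess_sup_on M (near_ess_sup M \<epsilon> f) g - ess_inf_on M (near_ess_inf M \<epsilon> f) g) \<longlongrightarrow> \<alpha>' G)
                (at_right 0)))))"
proof (rule conjI; intro ballI allI impI)
  let ?C = "count_space X"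
  fix f assume f0: "f \<in> vcarrier (linf X) - {vzero (linf X)}"
  then have fX: "f \<in> vcarrier (linf X)" by simp
  note f = linf_ess_bdd[OF fX] and nz = linf_not_AE_zero[OF f0]
    and nn = nonnull_count_space[OF assms]
  note sup = ess_sup_on_count_space[OF _ order_refl assms]
    and inf = ess_inf_on_count_space[OF _ order_refl assms]
  note near = near_sup_ess_sup_on_count_space[OF f _ assms] near_inf_ess_inf_on_count_space[OF f _ assms]
    near_sup_ess_sup_on_count_space[OF ess_bdd_abs[OF f] ess_bdd_mult_sgn[OF f] assms]
  \<comment> \<open>The functionals see only the values on \<open>X\<close>, so restriction does not
    change them; this is the link between \<open>\<Phi>\<close> and \<open>\<phi>\<close> in the
    transfer.\<close>
  have restr: "(SUP x\<in>X. restrict u X x) = ess_sup ?C u" "(INF x\<in>X. restrict u X x) = ess_inf ?C u"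
    "vnorm (linf X) (restrict u X) = ess_sup ?C (\<lambda>x. \<bar>u x\<bar>)"
    if "u \<in> ess_bdd ?C" for u
    using sup[OF that] inf[OF that] sup[OF ess_bdd_abs[OF that]] by (simp_all add: linf_def)
  let ?thesis_at = "\<lambda>\<Phi> E. \<exists>\<delta>'. has_hadamard_deriv (linf X) (vcarrier (linf X)) \<Phi> f \<delta>' \<and>
    (\<forall>g \<in> vcarrier (linf X). (E g \<longlongrightarrow> \<delta>' g) (at_right 0))"
  have "?thesis_at (vnorm (linf X)) (\<lambda>g \<epsilon>. SUP x \<in> near_sup X \<epsilon> (\<lambda>x. \<bar>f x\<bar>). g x * sgn (f x))"
    by (rule has_hadamard_deriv_linf[OF assms fX hadamard_limit_ess_norm[OF nz f]])
      (simp_all only: restr near)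
  moreover have "?thesis_at (\<lambda>u. SUP x\<in>X. u x) (\<lambda>g \<epsilon>. SUP x \<in> near_sup X \<epsilon> f. g x)"
    by (rule has_hadamard_deriv_linf[OF assms fX hadamard_limit_ess_sup[OF nn f]])
      (simp_all only: restr near)
  moreover have "?thesis_at (\<lambda>u. INF x\<in>X. u x) (\<lambda>g \<epsilon>. INF x \<in> near_inf X \<epsilon> f. g x)"
    by (rule has_hadamard_deriv_linf[OF assms fX hadamard_limit_ess_inf[OF nn f]])
      (simp_all only: restr near)
  moreover have "?thesis_at (\<lambda>u. (SUP x\<in>X. u x) - (INF x\<in>X. u x))
      (\<lambda>g \<epsilon>. (SUP x \<in> near_sup X \<epsilon> f. g x) - (INF x \<in> near_inf X \<epsilon> f. g x))"
    by (rule has_hadamard_deriv_linf[OF assms fX hadamard_limit_diff[OF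
          hadamard_limit_ess_sup[OF nn f] hadamard_limit_ess_inf[OF nn f]]])
      (simp_all only: restr near)
  ultimately show "?thesis_at (vnorm (linf X)) (\<lambda>g \<epsilon>. SUP x \<in> near_sup X \<epsilon> (\<lambda>x. \<bar>f x\<bar>). g x * sgn (f x)) \<and>
    ?thesis_at (\<lambda>u. SUP x\<in>X. u x) (\<lambda>g \<epsilon>. SUP x \<in> near_sup X \<epsilon> f. g x) \<and>
    ?thesis_at (\<lambda>u. INF x\<in>X. u x) (\<lambda>g \<epsilon>. INF x \<in> near_inf X \<epsilon> f. g x) \<and>
    ?thesis_at (\<lambda>u. (SUP x\<in>X. u x) - (INF x\<in>X. u x))
      (\<lambda>g \<epsilon>. (SUP x \<in> near_sup X \<epsilon> f. g x) - (INF x \<in> near_inf X \<epsilon> f. g x))"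
    by (intro conjI)
next
  fix M :: "'a measure" and F
  assume F: "F \<in> vcarrier (Linf M) - {vzero (Linf M)}"
  let ?thesis_at = "\<lambda>\<Phi> E. \<exists>\<delta>'. has_hadamard_deriv (Linf M) (vcarrier (Linf M)) \<Phi> F \<delta>' \<and>
    (\<forall>G \<in> vcarrier (Linf M). \<forall>f\<in>F. \<forall>g\<in>G. (E f g \<longlongrightarrow> \<delta>' G) (at_right 0))"
  \<comment> \<open>Equal classes have equal \<open>ess_sup\<close> and \<open>ess_inf\<close>, so
    the difference respects a.e. equality and \<open>on_class\<close> reads off its value.\<close>
  have "on_class (\<lambda>u. ess_sup M u - ess_inf M u) (ae_rel M `` {u}) = ess_sup M u - ess_inf M u"
    if u: "u \<in> ess_bdd M" for u
  proof (rule on_class_eq[OF u])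
    fix v assume uv: "(u, v) \<in> ae_rel M"
    then have "v \<in> ess_bdd M" "ae_rel M `` {v} = ae_rel M `` {u}"
      using equiv_class_eq[OF equiv_ae_rel uv] by (auto simp: ae_rel_def)
    then show "ess_sup M v - ess_inf M v = ess_sup M u - ess_inf M u"
      using u ess_sup_class ess_inf_class by metis
  qed
  note cls = this ess_sup_class ess_inf_class vnorm_Linf_class
  have "?thesis_at (vnorm (Linf M))
      (\<lambda>f g \<epsilon>. ess_sup_on M (near_ess_sup M \<epsilon> (\<lambda>x. \<bar>f x\<bar>)) (\<lambda>x. g x * sgn (f x)))"
    by (rule has_hadamard_deriv_Linf[OF F hadamard_limit_ess_norm cls(4)])
  \<comment> \<open>The norm took the nonzero condition on representatives directly; for the other
    three functionals \<open>nonnull_if_not_AE\<close> converts it into the non-null space they ask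
    for.\<close>
  moreover have "?thesis_at (on_class (ess_sup M)) (\<lambda>f g \<epsilon>. ess_sup_on M (near_ess_sup M \<epsilon> f) g)"
    by (rule has_hadamard_deriv_Linf[OF F hadamard_limit_ess_sup[OF nonnull_if_not_AE] cls(2)])
  moreover have "?thesis_at (on_class (ess_inf M)) (\<lambda>f g \<epsilon>. ess_inf_on M (near_ess_inf M \<epsilon> f) g)"
    by (rule has_hadamard_deriv_Linf[OF F hadamard_limit_ess_inf[OF nonnull_if_not_AE] cls(3)])
  moreover have "?thesis_at (on_class (\<lambda>u. ess_sup M u - ess_inf M u))
      (\<lambda>f g \<epsilon>. ess_sup_on M (near_ess_sup M \<epsilon> f) g - ess_inf_on M (near_ess_inf M \<epsilon> f) g)"
    by (rule has_hadamard_deriv_Linf[OF F hadamard_limit_diff[OF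
          hadamard_limit_ess_sup[OF nonnull_if_not_AE] hadamard_limit_ess_inf[OF nonnull_if_not_AE]] cls(1)])
  ultimately show "?thesis_at (vnorm (Linf M))
      (\<lambda>f g \<epsilon>. ess_sup_on M (near_ess_sup M \<epsilon> (\<lambda>x. \<bar>f x\<bar>)) (\<lambda>x. g x * sgn (f x))) \<and>
    ?thesis_at (on_class (ess_sup M)) (\<lambda>f g \<epsilon>. ess_sup_on M (near_ess_sup M \<epsilon> f) g) \<and>
    ?thesis_at (on_class (ess_inf M)) (\<lambda>f g \<epsilon>. ess_inf_on M (near_ess_inf M \<epsilon> f) g) \<and>
    ?thesis_at (on_class (\<lambda>u. ess_sup M u - ess_inf M u))
      (\<lambda>f g \<epsilon>. ess_sup_on M (near_ess_sup M \<epsilon> f) g - ess_inf_on M (near_ess_inf M \<epsilon> f) g)"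
    by (intro conjI)
qed

end
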